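(* If $\mu$ is an expansive measure of a continuous flow $\phi$ on a compact metric space $X$, then $\mu$ is expansive for the homeomorphism $\phi_T:X\to X$ for every $T\in\mathbb{R}$ with $T\neq 0$.
   Context: Let $(X,d)$ be a metric space. A flow of $X$ is a map $\phi:\mathbb{R}\times X\to X$, written $\phi_t(x)=\phi(t,x)$, with $\phi_0(x)=x$ and $\phi(t,\phi(s,x))=\phi(t+s,x)$ for all $s,t\in\mathbb{R}$, $x\in X$; it is continuous if it is continuous as a map $\mathbb{R}\times X\to X$, and then each time-$T$ map $\phi_T$ is a homeomorphism of $X$. $\mathcal{B}$ denotes the set of continuous maps $h:\mathbb{R}\to\mathbb{R}$ with $h(0)=0$. For $\delta>0$ and $x\in X$, $\Gamma_\delta(x)$ is the set of $y\in X$ for which there is $h\in\mathcal{B}$ with $d(\phi_t(x),\phi_{h(t)}(y))\le\delta$ for all $t\in\mathbb{R}$. A Borel measure is a non-negative $\sigma$-additive map on the Borel $\sigma$-algebra of $X$. For an arbitrary subset $B\subset X$ one writes $\mu(B)=0$ if $\mu(A)=0$ for every Borel set $A\subset B$. A Borel measure $\mu$ is expansive for the flow $\phi$ (an expansive measure of $\phi$) if there is $\delta>0$ such that $\mu(\Gamma_\delta(x))=0$ for every $x\in X$. A Borel measure $\mu$ is expansive for a homeomorphism $f:X\to X$ if there is $\delta>0$ such that $\mu(\hat\Gamma_\delta(x))=0$ for every $x\in X$, where $\hat\Gamma_\delta(x)=\{y\in X: d(f^n(x),f^n(y))\le\delta,\ \forall n\in\mathbb{Z}\}$. *)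

theory Defs
  imports "HOL-Analysis.Analysis"
begin

text \<open>
  The metric space \<open>X\<close> is the universe of a type of class \<open>metric_space\<close>; a map
  \<open>\<real> \<times> X \<rightarrow> X\<close> is written in curried form, so that \<open>\<phi> t\<close> is the time-\<open>t\<close> map.
\<close>

definition is_flow :: "(real \<Rightarrow> 'a \<Rightarrow> 'a) \<Rightarrow> bool" where
  "is_flow \<phi> \<longleftrightarrow> (\<forall>x. \<phi> 0 x = x) \<and> (\<forall>t s x. \<phi> t (\<phi> s x) = \<phi> (t + s) x)"

definition continuous_flow :: "(real \<Rightarrow> 'a::metric_space \<Rightarrow> 'a) \<Rightarrow> bool" where
  "continuous_flow \<phi> \<longleftrightarrow> is_flow \<phi> \<and> continuous_on UNIV (\<lambda>(t, x). \<phi> t x)"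

text \<open>
  The set \<open>\<B>\<close>. Its members are not required to be monotone, injective or surjective.
\<close>

definition reparams :: "(real \<Rightarrow> real) set" where
  "reparams = {h. continuous_on UNIV h \<and> h 0 = 0}"

definition Gamma_flow :: "(real \<Rightarrow> 'a::metric_space \<Rightarrow> 'a) \<Rightarrow> real \<Rightarrow> 'a \<Rightarrow> 'a set" where
  "Gamma_flow \<phi> \<delta> x = {y. \<exists>h\<in>reparams. \<forall>t. dist (\<phi> t x) (\<phi> (h t) y) \<le> \<delta>}"

text \<open>
  Values of a Borel measure are in \<^typ>\<open>ennreal\<close>; neither finiteness nor
  \<open>\<sigma>\<close>-finiteness is imposed.
\<close>

definition borel_measure :: "'a::topological_space measure \<Rightarrow> bool" where
  "borel_measure \<mu> \<longleftrightarrow> sets \<mu> = sets borel"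

text \<open>
  The convention \<open>\<mu>(B) = 0\<close> for arbitrary, possibly non-Borel \<open>B\<close>. This is inner nullity;
  it is weaker than membership in \<^const>\<open>null_sets\<close> of the completion of \<open>\<mu>\<close>.
\<close>

definition vanishes_on :: "'a::topological_space measure \<Rightarrow> 'a set \<Rightarrow> bool" where
  "vanishes_on \<mu> B \<longleftrightarrow> (\<forall>A\<in>sets borel. A \<subseteq> B \<longrightarrow> emeasure \<mu> A = 0)"

definition expansive_measure_flow ::
    "'a::metric_space measure \<Rightarrow> (real \<Rightarrow> 'a \<Rightarrow> 'a) \<Rightarrow> bool" where
  "expansive_measure_flow \<mu> \<phi> \<longleftrightarrow>
     borel_measure \<mu> \<and> (\<exists>\<delta>>0. \<forall>x. vanishes_on \<mu> (Gamma_flow \<phi> \<delta> x))"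

text \<open>The iterate \<open>f\<^sup>n\<close> of a bijection for integer \<open>n\<close>.\<close>

definition int_iterate :: "('a \<Rightarrow> 'a) \<Rightarrow> int \<Rightarrow> 'a \<Rightarrow> 'a" where
  "int_iterate f n = (if n \<ge> 0 then f ^^ nat n else inv f ^^ nat (- n))"

definition Gamma_homeo :: "('a::metric_space \<Rightarrow> 'a) \<Rightarrow> real \<Rightarrow> 'a \<Rightarrow> 'a set" where
  "Gamma_homeo f \<delta> x =
     {y. \<forall>n::int. dist (int_iterate f n x) (int_iterate f n y) \<le> \<delta>}"

text \<open>
  Being a homeomorphism is part of the definition: otherwise \<^const>\<open>inv\<close>, and hence the
  negative iterates, would be meaningless.
\<close>

definition expansive_measure_homeo ::
    "'a::metric_space measure \<Rightarrow> ('a \<Rightarrow> 'a) \<Rightarrow> bool" where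
  "expansive_measure_homeo \<mu> f \<longleftrightarrow>
     borel_measure \<mu> \<and> homeomorphism UNIV UNIV f (inv f) \<and>
     (\<exists>\<delta>>0. \<forall>x. vanishes_on \<mu> (Gamma_homeo f \<delta> x))"

end

theory Submission
  imports Defs
begin

text \<open>
  The flow shadowing sets contain the homeomorphism shadowing sets, for suitable radii. Given the
  radius \<open>\<delta>\<close> of flow expansivity, compactness makes the maps \<open>\<phi> s\<close> with \<open>\<bar>s\<bar> \<le> \<bar>T\<bar>\<close> uniformly
  equicontinuous, which supplies \<open>\<epsilon>\<close> such that points at distance at most \<open>\<epsilon>\<close> stay at distance
  at most \<open>\<delta>\<close> during one period of length \<open>\<bar>T\<bar>\<close>. Every real time is an integer multiple of \<open>T\<close>
  plus a remainder of size at most \<open>\<bar>T\<bar>\<close>. So two orbits that are \<open>\<epsilon>\<close>-close at all times \<open>n T\<close>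
  are \<open>\<delta>\<close>-close at all times, and no change of time is needed to see it: the reparametrisation
  is the identity. A measure that vanishes on the larger sets vanishes on the smaller ones.
\<close>

lemma flow_inverse:
  assumes "is_flow \<phi>"
  shows "inv (\<phi> T) = \<phi> (- T)"
  using assms by (intro inv_equality) (simp_all add: is_flow_def)

lemma flow_funpow:
  assumes "is_flow \<phi>"
  shows "(\<phi> T ^^ n) x = \<phi> (real n * T) x"
  using assms by (induction n) (auto simp: is_flow_def algebra_simps)

lemma int_iterate_flow:
  assumes "is_flow \<phi>"
  shows "int_iterate (\<phi> T) n x = \<phi> (of_int n * T) x"
  by (simp add: int_iterate_def flow_inverse[OF assms] flow_funpow[OF assms])

lemma continuous_flow_time_map:
  assumes "continuous_flow \<phi>"
  shows "continuous_on UNIV (\<phi> t)"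
proof -
  have "continuous_on UNIV ((\<lambda>(t, x). \<phi> t x) \<circ> Pair t)"
    using assms unfolding continuous_flow_def
    by (intro continuous_on_compose continuous_intros) (auto elim: continuous_on_subset)
  then show ?thesis by (simp add: o_def)
qed

lemma homeomorphism_flow_time_map:
  assumes "continuous_flow \<phi>"
  shows "homeomorphism UNIV UNIV (\<phi> T) (inv (\<phi> T))"
proof -
  have flow: "is_flow \<phi>"
    using assms by (simp add: continuous_flow_def)
  have "homeomorphism UNIV UNIV (\<phi> T) (\<phi> (- T))"
    using flow by (intro homeomorphismI)
      (auto simp: is_flow_def intro: continuous_flow_time_map[OF assms])
  then show ?thesis by (simp add: flow_inverse[OF flow])
qed

text \<open>
  Heine--Cantor on the compact product of the time interval with the whole space; comparing pairs
  with equal time coordinate makes the modulus independent of that time.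
\<close>

lemma flow_equicontinuous_bounded_time:
  fixes \<phi> :: "real \<Rightarrow> 'a::metric_space \<Rightarrow> 'a"
  assumes "compact (UNIV :: 'a set)" and "continuous_flow \<phi>" and "\<delta> > 0"
  obtains \<epsilon> where "\<epsilon> > 0"
    and "\<And>s x y. \<bar>s\<bar> \<le> R \<Longrightarrow> dist x y \<le> \<epsilon> \<Longrightarrow> dist (\<phi> s x) (\<phi> s y) \<le> \<delta>"
proof -
  let ?K = "{- R..R} \<times> (UNIV :: 'a set)"
  have "uniformly_continuous_on ?K (\<lambda>(t, x). \<phi> t x)"
    using assms(1,2) unfolding continuous_flow_def
    by (intro compact_uniformly_continuous compact_Times) (auto elim: continuous_on_subset)
  then obtain \<eta> where "\<eta> > 0"
    and \<eta>: "\<And>p q. p \<in> ?K \<Longrightarrow> q \<in> ?K \<Longrightarrow> dist q p < \<eta> \<Longrightarrow>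
              dist (case q of (t, x) \<Rightarrow> \<phi> t x) (case p of (t, x) \<Rightarrow> \<phi> t x) < \<delta>"
    using \<open>\<delta> > 0\<close> unfolding uniformly_continuous_on_def by meson
  show thesis
  proof
    \<comment> \<open>Halving turns the strict bound of uniform continuity into the non-strict one used by the
      shadowing sets.\<close>
    show "\<eta> / 2 > 0" using \<open>\<eta> > 0\<close> by simp
    fix s :: real and x y :: 'a
    assume "\<bar>s\<bar> \<le> R" and "dist x y \<le> \<eta> / 2"
    then show "dist (\<phi> s x) (\<phi> s y) \<le> \<delta>"
      using \<eta>[of "(s, y)" "(s, x)"] \<open>\<eta> > 0\<close> by (force simp: dist_Pair_Pair abs_le_iff)
  qed
qed

lemma Gamma_homeo_subset_Gamma_flow:
  assumes flow: "is_flow \<phi>" and "T \<noteq> 0"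
    and close: "\<And>s x y. \<bar>s\<bar> \<le> \<bar>T\<bar> \<Longrightarrow> dist x y \<le> \<epsilon> \<Longrightarrow> dist (\<phi> s x) (\<phi> s y) \<le> \<delta>"
  shows "Gamma_homeo (\<phi> T) \<epsilon> x \<subseteq> Gamma_flow \<phi> \<delta> x"
proof
  fix y
  assume "y \<in> Gamma_homeo (\<phi> T) \<epsilon> x"
  then have near: "dist (\<phi> (of_int n * T) x) (\<phi> (of_int n * T) y) \<le> \<epsilon>" for n
    by (simp add: Gamma_homeo_def int_iterate_flow[OF flow])
  have "dist (\<phi> t x) (\<phi> t y) \<le> \<delta>" for t
  proof -
    define n where "n = \<lfloor>t / T\<rfloor>"
    define s where "s = frac (t / T) * T"
    have "s + of_int n * T = t / T * T"
      unfolding s_def n_def frac_def by (simp only: flip: distrib_right) simp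
    then have t: "s + of_int n * T = t"
      using \<open>T \<noteq> 0\<close> by simp
    have "\<bar>s\<bar> \<le> \<bar>T\<bar>"
      using frac_lt_1[of "t / T"] by (simp add: s_def abs_mult mult_left_le_one_le)
    from close[OF this near[of n]] show ?thesis
      using flow by (simp add: is_flow_def t)
  qed
  moreover have "(\<lambda>t. t) \<in> reparams"
    by (simp add: reparams_def)
  ultimately show "y \<in> Gamma_flow \<phi> \<delta> x"
    unfolding Gamma_flow_def by (intro CollectI bexI[of _ "\<lambda>t. t"] allI)
qed

lemma vanishes_on_subset:
  assumes "vanishes_on \<mu> B" and "A \<subseteq> B"
  shows "vanishes_on \<mu> A"
  using assms unfolding vanishes_on_def by blast

theorem theorem2p3:
  fixes \<phi> :: "real \<Rightarrow> 'a::metric_space \<Rightarrow> 'a" and \<mu> :: "'a measure" and T :: real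
  assumes "compact (UNIV :: 'a set)"
    and "continuous_flow \<phi>"
    and "expansive_measure_flow \<mu> \<phi>"
    and "T \<noteq> 0"
  shows "expansive_measure_homeo \<mu> (\<phi> T)"
proof -
  have flow: "is_flow \<phi>"
    using assms(2) by (simp add: continuous_flow_def)
  obtain \<delta> where "\<delta> > 0" and \<delta>: "\<And>x. vanishes_on \<mu> (Gamma_flow \<phi> \<delta> x)"
    and borel: "borel_measure \<mu>"
    using assms(3) unfolding expansive_measure_flow_def by blast
  obtain \<epsilon> where "\<epsilon> > 0"
    and \<epsilon>: "\<And>s x y. \<bar>s\<bar> \<le> \<bar>T\<bar> \<Longrightarrow> dist x y \<le> \<epsilon> \<Longrightarrow> dist (\<phi> s x) (\<phi> s y) \<le> \<delta>"
    using flow_equicontinuous_bounded_time[OF assms(1,2) \<open>\<delta> > 0\<close>, of "\<bar>T\<bar>"] by blast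
  have "vanishes_on \<mu> (Gamma_homeo (\<phi> T) \<epsilon> x)" for x
    using \<delta> Gamma_homeo_subset_Gamma_flow[OF flow assms(4) \<epsilon>] by (rule vanishes_on_subset)
  then show ?thesis
    using borel homeomorphism_flow_time_map[OF assms(2)] \<open>\<epsilon> > 0\<close>
    unfolding expansive_measure_homeo_def by blast
qed

end
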